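(* Let $f:\mathbb{N}\to\mathbb{C}$ be a multiplicative function, let $n\in\mathbb{N}$, and suppose $f(p)\neq 1$ for every prime $p$ that divides $n$. Then $$\sum_{d\mid n}\mu(d)\,\omega(d)\, f(d) = \left(\sum_{d\mid n}\mu(d) f(d)\right)\left( \sum_{p\mid n}\frac{f(p)}{f(p)-1}\right).$$
   Context: $\mathbb{N}=\{1,2,3,\ldots\}$. $\omega(n)$ is the number of distinct prime factors of $n$, with $\omega(1)=0$. $\mu$ is the Möbius function: $\mu(1)=1$, $\mu(n)=0$ if $n$ is not squarefree, and $\mu(n)=(-1)^{\omega(n)}$ if $n$ is squarefree. A multiplicative function satisfies $f(1)=1$ and $f(nm)=f(n)f(m)$ whenever $\gcd(n,m)=1$. $\sum_{d\mid n}$ is over all positive divisors $d$ of $n$ (including $1$ and $n$); $\sum_{p\mid n}$ is over the distinct primes $p$ dividing $n$, and is $0$ when $n=1$. *)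

theory Defs
  imports Complex_Main
    "HOL-Computational_Algebra.Primes"
    "HOL-Computational_Algebra.Squarefree"
begin

text \<open>
  The positive integers are rendered as type \<^typ>\<open>nat\<close> with explicit positivity assumptions;
  values at \<^term>\<open>0 :: nat\<close> carry no meaning.
\<close>

definition omega :: "nat \<Rightarrow> nat" where
  "omega n = card {p. prime p \<and> p dvd n}"

definition moebius :: "nat \<Rightarrow> int" where
  "moebius n = (if squarefree n then (- 1) ^ omega n else 0)"

definition multiplicative :: "(nat \<Rightarrow> complex) \<Rightarrow> bool" where
  "multiplicative f \<longleftrightarrow>
     f 1 = 1 \<and> (\<forall>m n. m > 0 \<longrightarrow> n > 0 \<longrightarrow> coprime n m \<longrightarrow> f (n * m) = f n * f m)"

end

theory Submission
  imports Defs
begin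

text \<open>
  Since \<^term>\<open>moebius\<close> vanishes off the squarefree numbers, both divisor sums run over products of
  sets of prime divisors of \<^term>\<open>n\<close>, and the claim becomes the logarithmic derivative at \<open>t = 1\<close>
  of \<open>\<Prod>p\<in>P. (1 + t * g p) = \<Sum>S\<in>Pow P. t ^ card S * prod g S\<close> with \<open>g p = - f p\<close>.
\<close>

lemma sum_Pow_insert:
  fixes h :: "'a set \<Rightarrow> 'b::comm_monoid_add"
  assumes "finite A" "a \<notin> A"
  shows "sum h (Pow (insert a A)) = sum h (Pow A) + (\<Sum>S\<in>Pow A. h (insert a S))"
proof -
  have "inj_on (insert a) (Pow A)"
    using assms(2) by (auto simp: inj_on_def)
  then have "sum h (insert a ` Pow A) = (\<Sum>S\<in>Pow A. h (insert a S))"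
    by (simp add: sum.reindex)
  moreover have "sum h (Pow (insert a A)) = sum h (Pow A) + sum h (insert a ` Pow A)"
    unfolding Pow_insert using assms by (intro sum.union_disjoint) auto
  ultimately show ?thesis
    by simp
qed

lemma sum_Pow_prod:
  fixes g :: "'a \<Rightarrow> 'b::comm_semiring_1"
  assumes "finite A"
  shows "(\<Sum>S\<in>Pow A. prod g S) = (\<Prod>a\<in>A. 1 + g a)"
  using prod_add[OF assms, of g "\<lambda>_. 1"] by (simp add: add.commute)

text \<open>This is the differentiated product expansion at \<open>t = 1\<close>, where
  \<open>card S\<close> is the exponent brought down from \<open>t ^ card S\<close>. Induction on
  \<open>A\<close> replaces the derivative; the nonvanishing of \<open>1 + g a\<close> permits
  writing the sum of products with one factor omitted as a quotient.\<close>

lemma sum_Pow_card_prod: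
  fixes g :: "'a \<Rightarrow> 'b::field"
  assumes "finite A" "\<And>a. a \<in> A \<Longrightarrow> 1 + g a \<noteq> 0"
  shows "(\<Sum>S\<in>Pow A. of_nat (card S) * prod g S) =
         (\<Prod>a\<in>A. 1 + g a) * (\<Sum>a\<in>A. g a / (1 + g a))"
  using assms
proof (induction A rule: finite_induct)
  case empty
  then show ?case by simp
next
  case (insert a A)
  let ?Q = "\<Prod>a\<in>A. 1 + g a" and ?L = "\<Sum>a\<in>A. g a / (1 + g a)"
  have IH: "(\<Sum>S\<in>Pow A. of_nat (card S) * prod g S) = ?Q * ?L"
    using insert by simp
  \<comment> \<open>Adjoining \<open>a\<close> raises the cardinality by one, which produces the
    extra summand \<open>prod g S\<close>; its total is \<open>?Q\<close> by
    \<open>sum_Pow_prod\<close>.\<close>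
  have "(\<Sum>S\<in>Pow A. of_nat (card (insert a S)) * prod g (insert a S)) =
        (\<Sum>S\<in>Pow A. g a * (prod g S + of_nat (card S) * prod g S))"
  proof (rule sum.cong)
    fix S assume "S \<in> Pow A"
    then have "finite S" "a \<notin> S"
      using insert.hyps finite_subset by auto
    then show "of_nat (card (insert a S)) * prod g (insert a S) =
               g a * (prod g S + of_nat (card S) * prod g S)"
      by (simp add: algebra_simps)
  qed simp
  also have "\<dots> = g a * (?Q + ?Q * ?L)"
    by (simp add: sum_distrib_left[symmetric] sum.distrib IH sum_Pow_prod insert.hyps)
  finally have "(\<Sum>S\<in>Pow (insert a A). of_nat (card S) * prod g S) =
                ?Q * ?L + g a * (?Q + ?Q * ?L)"
    using insert.hyps by (simp add: sum_Pow_insert IH)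
  also have "\<dots> = (1 + g a) * ?Q * (g a / (1 + g a) + ?L)"
  proof -
    \<comment> \<open>Stated for arbitrary field elements, so that the product and the sum stay
      atomic during simplification.\<close>
    have "Q * L + x * (Q + Q * L) = (1 + x) * Q * (x / (1 + x) + L)" if "1 + x \<noteq> 0" for x Q L :: 'b
      using that by (simp add: distrib_left) (simp add: algebra_simps)
    then show ?thesis
      using insert.prems[of a] by blast
  qed
  finally show ?case
    using insert.hyps by simp
qed

text \<open>A prime dividing the product divides one of the prime factors, hence equals it. So
  \<open>S\<close> can be recovered from its product, and \<open>omega\<close> of the product is
  \<open>card S\<close>.\<close>

lemma prime_divisors_prod:
  fixes S :: "nat set"
  assumes "finite S" "\<And>p. p \<in> S \<Longrightarrow> prime p"
  shows "{p. prime p \<and> p dvd \<Prod>S} = S"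
  using assms by (auto simp: prime_dvd_prod_iff) (metis primes_dvd_imp_eq)

lemma squarefree_prod_primes:
  fixes S :: "nat set"
  assumes "\<And>p. p \<in> S \<Longrightarrow> prime p"
  shows "squarefree (\<Prod>S)"
  using assms by (intro squarefree_prod_coprime) (auto intro: squarefree_prime primes_coprime)

lemma prod_primes_dvd:
  fixes n :: nat
  assumes "finite S" "\<And>p. p \<in> S \<Longrightarrow> prime p \<and> p dvd n"
  shows "\<Prod>S dvd n"
  using assms
proof (induction S rule: finite_induct)
  case (insert p S)
  then have "coprime p (\<Prod>S)"
    by (intro prod_coprime_right primes_coprime) auto
  then show ?case
    using insert by (simp add: divides_mult)
qed simp

text \<open>All exponents in the prime factorization of a squarefree number are 1.\<close>

lemma prod_prime_divisors_squarefree: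
  fixes d :: nat
  assumes "squarefree d"
  shows "\<Prod>{p. prime p \<and> p dvd d} = d"
proof -
  have "d \<noteq> 0"
    using assms by (metis not_squarefree_0)
  then have eq: "{p. prime p \<and> p dvd d} = prime_factors d"
    by (auto simp: prime_factors_dvd)
  have "(\<Prod>p\<in>prime_factors d. p ^ multiplicity p d) = d"
    using \<open>d \<noteq> 0\<close> by (simp add: prod_prime_factors)
  moreover have "(\<Prod>p\<in>prime_factors d. p ^ multiplicity p d) = \<Prod>(prime_factors d)"
    using assms \<open>d \<noteq> 0\<close> by (intro prod.cong) (auto simp: squarefree_factorial_semiring')
  ultimately show ?thesis
    using eq by simp
qed

lemma bij_betw_prod_squarefree_divisors:
  fixes n :: nat
  assumes "n > 0"
  shows "bij_betw Prod (Pow {p. prime p \<and> p dvd n}) {d. d dvd n \<and> squarefree d}"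
proof (rule bij_betw_byWitness[where f' = "\<lambda>d. {p. prime p \<and> p dvd d}"])
  let ?P = "{p. prime p \<and> p dvd n}"
  \<comment> \<open>Prime divisors of \<open>n\<close> lie among its divisors, of which there are
    finitely many because \<open>n > 0\<close>.\<close>
  have fin: "finite S" if "S \<in> Pow ?P" for S
    by (rule finite_subset[of _ "{d. d dvd n}"]) (use that assms in auto)
  show "\<forall>S\<in>Pow ?P. {p. prime p \<and> p dvd \<Prod>S} = S"
    by (intro ballI prime_divisors_prod fin) auto
  show "\<forall>d\<in>{d. d dvd n \<and> squarefree d}. \<Prod>{p. prime p \<and> p dvd d} = d"
    by (simp add: prod_prime_divisors_squarefree)
  show "Prod ` Pow ?P \<subseteq> {d. d dvd n \<and> squarefree d}"
  proof safe
    fix S assume S: "S \<subseteq> ?P"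
    then show "\<Prod>S dvd n"
      by (intro prod_primes_dvd fin) auto
    show "squarefree (\<Prod>S)"
      using S by (intro squarefree_prod_primes) auto
  qed
  show "(\<lambda>d. {p. prime p \<and> p dvd d}) ` {d. d dvd n \<and> squarefree d} \<subseteq> Pow ?P"
    by (auto intro: dvd_trans)
qed

text \<open>Distinct primes are coprime, so the factors split off one at a time; positivity is
  checked because \<open>multiplicative\<close> speaks of positive arguments only.\<close>

lemma multiplicative_prod_primes:
  assumes "multiplicative f" "finite S" "\<And>p. p \<in> S \<Longrightarrow> prime p"
  shows "f (\<Prod>S) = prod f S"
  using assms(2,3)
proof (induction S rule: finite_induct)
  case empty
  then show ?case
    using assms(1) by (simp add: multiplicative_def)
next
  case (insert p S)
  have "coprime p (\<Prod>S)"
    using insert by (intro prod_coprime_right primes_coprime) auto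
  moreover have "p > 0" "\<Prod>S > 0"
    using insert.prems by (auto intro!: prod_pos simp: prime_gt_0_nat)
  ultimately have "f (p * \<Prod>S) = f p * f (\<Prod>S)"
    using assms(1) by (simp add: multiplicative_def)
  then show ?case
    using insert by simp
qed

text \<open>The weight \<open>h\<close> lets one reindexing serve both divisor sums:
  \<open>of_nat\<close> gives the sum with \<open>omega\<close>, the constant 1 the plain one. The
  sign \<open>(- 1) ^ card S\<close> is absorbed into the factors \<open>- f p\<close>.\<close>

lemma sum_moebius_divisors:
  fixes f :: "nat \<Rightarrow> complex" and h :: "nat \<Rightarrow> complex"
  assumes "multiplicative f" "n > 0"
  shows "(\<Sum>d | d dvd n. of_int (moebius d) * h (omega d) * f d) =
         (\<Sum>S\<in>Pow {p. prime p \<and> p dvd n}. h (card S) * (\<Prod>p\<in>S. - f p))"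
proof -
  let ?P = "{p. prime p \<and> p dvd n}"
  let ?F = "\<lambda>d. of_int (moebius d) * h (omega d) * f d"
  have "(\<Sum>d | d dvd n. ?F d) = (\<Sum>d | d dvd n \<and> squarefree d. ?F d)"
    using assms(2) by (intro sum.mono_neutral_right) (auto simp: moebius_def)
  also have "\<dots> = (\<Sum>S\<in>Pow ?P. ?F (\<Prod>S))"
    by (rule sum.reindex_bij_betw[OF bij_betw_prod_squarefree_divisors[OF assms(2)], symmetric])
  also have "\<dots> = (\<Sum>S\<in>Pow ?P. h (card S) * (\<Prod>p\<in>S. - f p))"
  proof (rule sum.cong)
    fix S assume S: "S \<in> Pow ?P"
    have fin: "finite S"
      by (rule finite_subset[of _ "{d. d dvd n}"]) (use S assms(2) in auto)
    have prime: "\<And>p. p \<in> S \<Longrightarrow> prime p"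
      using S by auto
    have "omega (\<Prod>S) = card S"
      unfolding omega_def by (simp only: prime_divisors_prod[OF fin prime])
    moreover from this have "moebius (\<Prod>S) = (- 1) ^ card S"
      unfolding moebius_def by (simp only: squarefree_prod_primes[OF prime] if_True)
    moreover have "f (\<Prod>S) = prod f S"
      by (rule multiplicative_prod_primes[OF assms(1) fin prime])
    ultimately show "?F (\<Prod>S) = h (card S) * (\<Prod>p\<in>S. - f p)"
      by (simp add: prod_uminus)
  qed simp
  finally show ?thesis .
qed

theorem corollary3p2:
  fixes f :: "nat \<Rightarrow> complex" and n :: nat
  assumes "multiplicative f"
    and "n > 0"
    and "\<And>p. prime p \<Longrightarrow> p dvd n \<Longrightarrow> f p \<noteq> 1"
  shows "(\<Sum>d | d dvd n. of_int (moebius d) * of_nat (omega d) * f d) =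
         (\<Sum>d | d dvd n. of_int (moebius d) * f d) *
         (\<Sum>p | prime p \<and> p dvd n. f p / (f p - 1))"
proof -
  let ?P = "{p. prime p \<and> p dvd n}"
  have fin: "finite ?P"
    using assms(2) by simp
  \<comment> \<open>With \<open>g p = - f p\<close>, the assumption \<open>f p \<noteq> 1\<close> is
    exactly the required \<open>1 + g p \<noteq> 0\<close>.\<close>
  have "(\<Sum>d | d dvd n. of_int (moebius d) * of_nat (omega d) * f d) =
        (\<Prod>p\<in>?P. 1 + - f p) * (\<Sum>p\<in>?P. - f p / (1 + - f p))"
    unfolding sum_moebius_divisors[OF assms(1,2), of of_nat]
    by (rule sum_Pow_card_prod[OF fin]) (use assms(3) in auto)
  also have "(\<Prod>p\<in>?P. 1 + - f p) = (\<Sum>d | d dvd n. of_int (moebius d) * f d)"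
    using sum_moebius_divisors[OF assms(1,2), of "\<lambda>_. 1"] sum_Pow_prod[OF fin, of "\<lambda>p. - f p"]
    by simp
  also have "(\<Sum>p\<in>?P. - f p / (1 + - f p)) = (\<Sum>p\<in>?P. f p / (f p - 1))"
    proof (rule sum.cong)
    show "- f p / (1 + - f p) = f p / (f p - 1)" for p
      using minus_divide_divide[of "f p" "f p - 1"] by simp
  qed simp
  finally show ?thesis .
qed

end
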